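(* Let $P\colon\mathcal C^{op}\to\mathbf{InfSL}$ and $R\colon\mathcal D^{op}\to\mathbf{InfSL}$ be such that $(P,(\mathrm{id}_{\mathcal C},\zeta_P))$ and $(R,(\mathrm{id}_{\mathcal D},\zeta_R))$ are $T_e$-algebras, and let $(F,b)\colon P\to R$ be a 1-cell of $\mathbf{PD}$. Then $((F,b),\mathrm{id}_F)$ is a lax morphism of $T_e$-algebras, and the 2-cell of primary doctrines $$\mathrm{id}_F\colon (\mathrm{id}_{\mathcal D},\zeta_R)\,(F,b^e)\Rightarrow (F,b)\,(\mathrm{id}_{\mathcal C},\zeta_P)$$ is the unique 2-cell $\theta$ making $((F,b),\theta)$ a lax morphism. Therefore the 2-monad $T_e\colon\mathbf{PD}\to\mathbf{PD}$ is lax-idempotent.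
   Context: An inf-semilattice is a poset with finite meets (including a top element $\top$); $\mathbf{InfSL}$ is the category of inf-semilattices and finite-meet-preserving maps. No size distinctions are made between categories and fibres. A primary doctrine is a functor $P\colon \mathcal C^{op}\to\mathbf{InfSL}$ with $\mathcal C$ a category with finite products; for $f\colon A\to B$ write $P_f\colon P(B)\to P(A)$ for its action. A morphism $X\to A$ is called a projection if it is one of the legs of a binary product diagram $A\leftarrow X\to B$ for some object $B$. A primary doctrine $P$ is existential if for every projection $\mathrm{pr}\colon X\to A$ the map $P_{\mathrm{pr}}$ has a left adjoint $\exists_{\mathrm{pr}}$ and these satisfy: (Beck-Chevalley) for any pullback square $f\,\mathrm{pr}'=\mathrm{pr} f'$ with $\mathrm{pr}\colon X\to A$, $\mathrm{pr}'\colon X'\to A'$ projections, $\exists_{\mathrm{pr}'}P_{f'}(\beta)=P_f\exists_{\mathrm{pr}}(\beta)$ for all $\beta\in P(X)$; (Frobenius) $\exists_{\mathrm{pr}}(P_{\mathrm{pr}}(\alpha)\wedge\beta)=\alpha\wedge\exists_{\mathrm{pr}}(\beta)$ for all $\alpha\in P(A)$, $\beta\in P(X)$. The 2-category $\mathbf{PD}$: 0-cells are primary doctrines; 1-cells from $P\colon\mathcal C^{op}\to\mathbf{InfSL}$ to $R\colon\mathcal D^{op}\to\mathbf{InfSL}$ are pairs $(F,b)$ with $F\colon\mathcal C\to\mathcal D$ a finite-product-preserving functor and $b\colon P\to R\circ F^{op}$ a natural transformation whose components preserve finite meets; 2-cells $(F,b)\Rightarrow(G,c)$ are natural transformations $\theta\colon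 F\to G$ with $b_A(\alpha)\le R_{\theta_A}(c_A(\alpha))$ for all $A$, $\alpha\in P(A)$. Existential completion: $P^e(A)$ is the poset reflection of the preorder of pairs $(g\colon B\to A,\ \alpha\in P(B))$ with $g$ a projection, where $(h\colon B\to A,\alpha)\le(f\colon D\to A,\gamma)$ iff there is $w\colon B\to D$ with $fw=h$ and $\alpha\le P_w(\gamma)$; for $f\colon A\to B$, $P^e_f(g\colon C\to B,\beta)=(f^*g,\ P_{g^*f}(\beta))$, with $f^*g\colon D\to A$, $g^*f\colon D\to C$ a pullback of $g$ along $f$. $P^e$ is an existential doctrine, with left adjoints along projections $\exists^e_f(h,\alpha)=(fh,\alpha)$. The 2-monad $(T_e,\mu,\eta)$ on $\mathbf{PD}$: $T_e(P)=P^e$; $T_e(F,b)=(F,b^e)$ with $b^e_A(g\colon C\to A,\alpha)=(Fg\colon FC\to FA,b_C(\alpha))$; $T_e(\theta)=\theta$; $\eta_P=(\mathrm{id}_{\mathcal C},\iota_P)\colon P\to P^e$ with $(\iota_P)_A(\alpha)=(\mathrm{id}_A,\alpha)$; $\mu_P=(\mathrm{id}_{\mathcal C},\zeta_{P^e})\colon (P^e)^e\to P^e$, where for an existential doctrine $Q$, $(\zeta_Q)_A\colon Q^e(A)\to Q(A)$ is $(\zeta_Q)_A(f\colon C\to A,\alpha)=\exists_f(\alpha)$. For a 2-monad $(T,\mu,\eta)$: a $T$-algebra is $(A,a)$ with $a\colon TA\to A$ a 1-cell, $a\cdot Ta=a\cdot\mu_A$ and $a\cdot\eta_A=1_A$.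 (A doctrine $P$ underlying a $T_e$-algebra is existential, so $\zeta_P$ is defined.) A lax $T$-morphism $(A,a)\to(B,b)$ is a pair $(f,\overline f)$ with $f\colon A\to B$ a 1-cell and $\overline f\colon b\cdot Tf\Rightarrow f\cdot a$ a 2-cell such that $\overline f\cdot\mu_A=(\overline f\cdot Ta)\circ(b\cdot T\overline f)$ and $\overline f\cdot\eta_A=\mathrm{id}_f$. The 2-monad $T$ is lax-idempotent if for all $T$-algebras $(A,a),(B,b)$ and every 1-cell $f\colon A\to B$ there is a unique 2-cell $\overline f\colon b\cdot Tf\Rightarrow f\cdot a$ such that $(f,\overline f)$ is a lax $T$-morphism. *)

theory Defs
  imports "HOL-Algebra.Lattice" "HOL-Library.FuncSet" "HOL-Library.Infinite_Typeclass"
begin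

section \<open>Categories with finite products\<close>

text \<open>
  Objects, arrows and (later) elements of fibres all live in one universe \<open>'u\<close>.
  As in HOL-Algebra, the data of a structure are relevant only on its carriers. Maps that are
  compared for equality (functors, natural transformations) are extensional, i.e. take the value
  \<^const>\<open>undefined\<close> outside their domain.
\<close>

record 'u cat =
  Obj :: "'u set"
  Arr :: "'u set"
  Dom :: "'u \<Rightarrow> 'u"
  Cod :: "'u \<Rightarrow> 'u"
  ident :: "'u \<Rightarrow> 'u"
  Comp :: "'u \<Rightarrow> 'u \<Rightarrow> 'u"  (infixr \<open>\<cdot>\<index>\<close> 75)

definition Hom :: "'u cat \<Rightarrow> 'u \<Rightarrow> 'u \<Rightarrow> 'u set" where
  "Hom C A B = {f \<in> Arr C. Dom C f = A \<and> Cod C f = B}"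

locale category =
  fixes C :: "'u cat" (structure)
  assumes Dom_in_Obj: "f \<in> Arr C \<Longrightarrow> Dom C f \<in> Obj C"
    and Cod_in_Obj: "f \<in> Arr C \<Longrightarrow> Cod C f \<in> Obj C"
    and ident_in_Hom: "A \<in> Obj C \<Longrightarrow> ident C A \<in> Hom C A A"
    and Comp_in_Hom: "\<lbrakk>f \<in> Hom C X Y; g \<in> Hom C Y Z\<rbrakk> \<Longrightarrow> g \<cdot> f \<in> Hom C X Z"
    and Comp_ident: "f \<in> Hom C X Y \<Longrightarrow> f \<cdot> ident C X = f"
    and ident_Comp: "f \<in> Hom C X Y \<Longrightarrow> ident C Y \<cdot> f = f"
    and Comp_assoc: "\<lbrakk>f \<in> Hom C W X; g \<in> Hom C X Y; h \<in> Hom C Y Z\<rbrakk>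
      \<Longrightarrow> h \<cdot> (g \<cdot> f) = (h \<cdot> g) \<cdot> f"

definition is_terminal :: "'u cat \<Rightarrow> 'u \<Rightarrow> bool" where
  "is_terminal C T \<longleftrightarrow> T \<in> Obj C \<and> (\<forall>Y\<in>Obj C. \<exists>!h. h \<in> Hom C Y T)"

definition is_product :: "'u cat \<Rightarrow> 'u \<Rightarrow> 'u \<Rightarrow> 'u \<Rightarrow> 'u \<Rightarrow> 'u \<Rightarrow> bool" where
  "is_product C X A B p q \<longleftrightarrow> p \<in> Hom C X A \<and> q \<in> Hom C X B \<and>
     (\<forall>Y\<in>Obj C. \<forall>f\<in>Hom C Y A. \<forall>g\<in>Hom C Y B.
        \<exists>!h. h \<in> Hom C Y X \<and> p \<cdot>\<^bsub>C\<^esub> h = f \<and> q \<cdot>\<^bsub>C\<^esub> h = g)"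

locale fp_category = category +
  assumes terminal_exists: "\<exists>T. is_terminal C T"
    and product_exists: "\<lbrakk>A \<in> Obj C; B \<in> Obj C\<rbrakk> \<Longrightarrow> \<exists>X p q. is_product C X A B p q"

definition is_projection :: "'u cat \<Rightarrow> 'u \<Rightarrow> bool" where
  "is_projection C p \<longleftrightarrow> (\<exists>X A B q. is_product C X A B p q)"

definition is_pullback :: "'u cat \<Rightarrow> 'u \<Rightarrow> 'u \<Rightarrow> 'u \<Rightarrow> 'u \<Rightarrow> bool" where
  \<comment> \<open>\<open>p\<close> is a pullback of \<open>g\<close> along \<open>f\<close>, and \<open>q\<close> a pullback of \<open>f\<close> along \<open>g\<close>\<close>
  "is_pullback C f g p q \<longleftrightarrow>
     p \<in> Hom C (Dom C p) (Dom C f) \<and> q \<in> Hom C (Dom C p) (Dom C g) \<and>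
     f \<cdot>\<^bsub>C\<^esub> p = g \<cdot>\<^bsub>C\<^esub> q \<and>
     (\<forall>Y\<in>Obj C. \<forall>r\<in>Hom C Y (Dom C f). \<forall>s\<in>Hom C Y (Dom C g). f \<cdot>\<^bsub>C\<^esub> r = g \<cdot>\<^bsub>C\<^esub> s \<longrightarrow>
        (\<exists>!h. h \<in> Hom C Y (Dom C p) \<and> p \<cdot>\<^bsub>C\<^esub> h = r \<and> q \<cdot>\<^bsub>C\<^esub> h = s))"

record 'u cat_functor =
  fobj :: "'u \<Rightarrow> 'u"
  farr :: "'u \<Rightarrow> 'u"

definition is_functor :: "'u cat \<Rightarrow> 'u cat \<Rightarrow> 'u cat_functor \<Rightarrow> bool" where
  "is_functor C D F \<longleftrightarrow>
     fobj F \<in> Obj C \<rightarrow>\<^sub>E Obj D \<and> farr F \<in> Arr C \<rightarrow>\<^sub>E Arr D \<and>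
     (\<forall>A B. \<forall>f\<in>Hom C A B. farr F f \<in> Hom D (fobj F A) (fobj F B)) \<and>
     (\<forall>A\<in>Obj C. farr F (ident C A) = ident D (fobj F A)) \<and>
     (\<forall>X Y Z. \<forall>f\<in>Hom C X Y. \<forall>g\<in>Hom C Y Z. farr F (g \<cdot>\<^bsub>C\<^esub> f) = farr F g \<cdot>\<^bsub>D\<^esub> farr F f)"

definition preserves_finite_products :: "'u cat \<Rightarrow> 'u cat \<Rightarrow> 'u cat_functor \<Rightarrow> bool" where
  "preserves_finite_products C D F \<longleftrightarrow>
     (\<forall>T. is_terminal C T \<longrightarrow> is_terminal D (fobj F T)) \<and>
     (\<forall>X A B p q. is_product C X A B p q \<longrightarrow>
        is_product D (fobj F X) (fobj F A) (fobj F B) (farr F p) (farr F q))"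

definition id_functor :: "'u cat \<Rightarrow> 'u cat_functor" where
  "id_functor C = \<lparr>fobj = (\<lambda>A\<in>Obj C. A), farr = (\<lambda>f\<in>Arr C. f)\<rparr>"

definition comp_functor :: "'u cat \<Rightarrow> 'u cat_functor \<Rightarrow> 'u cat_functor \<Rightarrow> 'u cat_functor" where
  "comp_functor C G F =
     \<lparr>fobj = (\<lambda>A\<in>Obj C. fobj G (fobj F A)), farr = (\<lambda>f\<in>Arr C. farr G (farr F f))\<rparr>"

definition is_nat_trans ::
  "'u cat \<Rightarrow> 'u cat \<Rightarrow> 'u cat_functor \<Rightarrow> 'u cat_functor \<Rightarrow> ('u \<Rightarrow> 'u) \<Rightarrow> bool" where
  "is_nat_trans C D F G \<theta> \<longleftrightarrow> \<theta> \<in> extensional (Obj C) \<and>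
     (\<forall>A\<in>Obj C. \<theta> A \<in> Hom D (fobj F A) (fobj G A)) \<and>
     (\<forall>A B. \<forall>f\<in>Hom C A B. farr G f \<cdot>\<^bsub>D\<^esub> \<theta> A = \<theta> B \<cdot>\<^bsub>D\<^esub> farr F f)"

definition id_nat :: "'u cat \<Rightarrow> 'u cat \<Rightarrow> 'u cat_functor \<Rightarrow> 'u \<Rightarrow> 'u" where
  "id_nat C D F = (\<lambda>A\<in>Obj C. ident D (fobj F A))"

section \<open>Primary doctrines\<close>

locale inf_semilattice = lower_semilattice + weak_partial_order_top

definition inf_semilattice_hom :: "'u gorder \<Rightarrow> 'u gorder \<Rightarrow> ('u \<Rightarrow> 'u) \<Rightarrow> bool" where
  "inf_semilattice_hom L M h \<longleftrightarrow> h \<in> carrier L \<rightarrow> carrier M \<and> h \<top>\<^bsub>L\<^esub> = \<top>\<^bsub>M\<^esub> \<and>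
     (\<forall>x\<in>carrier L. \<forall>y\<in>carrier L. h (x \<sqinter>\<^bsub>L\<^esub> y) = h x \<sqinter>\<^bsub>M\<^esub> h y)"

record 'u doctrine =
  base :: "'u cat"
  fib :: "'u \<Rightarrow> 'u gorder"
  reidx :: "'u \<Rightarrow> 'u \<Rightarrow> 'u"

locale primary_doctrine =
  fixes P :: "'u doctrine"
  assumes base_fp: "fp_category (base P)"
    and fib_inf_semilattice: "A \<in> Obj (base P) \<Longrightarrow> inf_semilattice (fib P A)"
    and reidx_hom: "f \<in> Hom (base P) A B \<Longrightarrow> inf_semilattice_hom (fib P B) (fib P A) (reidx P f)"
    and reidx_ident: "\<lbrakk>A \<in> Obj (base P); \<alpha> \<in> carrier (fib P A)\<rbrakk>
      \<Longrightarrow> reidx P (ident (base P) A) \<alpha> = \<alpha>"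
    and reidx_Comp: "\<lbrakk>f \<in> Hom (base P) X Y; g \<in> Hom (base P) Y Z; \<alpha> \<in> carrier (fib P Z)\<rbrakk>
      \<Longrightarrow> reidx P (g \<cdot>\<^bsub>base P\<^esub> f) \<alpha> = reidx P f (reidx P g \<alpha>)"

text \<open>The 1-cells \<open>(F, b)\<close>, with \<open>b A\<close> the component of \<open>b\<close> at the object \<open>A\<close>, and the 2-cells.\<close>

type_synonym 'u doctrine_map = "'u cat_functor \<times> ('u \<Rightarrow> 'u \<Rightarrow> 'u)"

definition PD_1cells :: "'u doctrine \<Rightarrow> 'u doctrine \<Rightarrow> 'u doctrine_map set" where
  "PD_1cells P R = {(F, b).
     is_functor (base P) (base R) F \<and> preserves_finite_products (base P) (base R) F \<and>
     b \<in> extensional (Obj (base P)) \<and>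
     (\<forall>A\<in>Obj (base P). b A \<in> extensional (carrier (fib P A)) \<and>
        inf_semilattice_hom (fib P A) (fib R (fobj F A)) (b A)) \<and>
     (\<forall>A B. \<forall>f\<in>Hom (base P) A B. \<forall>\<beta>\<in>carrier (fib P B).
        b A (reidx P f \<beta>) = reidx R (farr F f) (b B \<beta>))}"

definition PD_2cells ::
  "'u doctrine \<Rightarrow> 'u doctrine \<Rightarrow> 'u doctrine_map \<Rightarrow> 'u doctrine_map \<Rightarrow> ('u \<Rightarrow> 'u) set" where
  "PD_2cells P R = (\<lambda>(F, b) (G, c). {\<theta>. is_nat_trans (base P) (base R) F G \<theta> \<and>
     (\<forall>A\<in>Obj (base P). \<forall>\<alpha>\<in>carrier (fib P A).
        b A \<alpha> \<sqsubseteq>\<^bsub>fib R (fobj F A)\<^esub> reidx R (\<theta> A) (c A \<alpha>))})"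

section \<open>2-categories, 2-monads and lax idempotency\<close>

text \<open>
  The operations of a 2-category and of a 2-monad on it. Operations on cells take as extra
  arguments the 0-cells \<open>A\<close>, \<open>B\<close>, \<open>C\<close> between which the cells live:
  \<^item> \<open>comp1 K A B C g f\<close> is \<open>g \<cdot> f\<close> for \<open>f: A \<rightarrow> B\<close> and \<open>g: B \<rightarrow> C\<close>;
  \<^item> \<open>comp2 K A B \<tau> \<theta>\<close> is the vertical composite \<open>\<tau> \<circ> \<theta>\<close> of 2-cells between 1-cells \<open>A \<rightarrow> B\<close>;
  \<^item> \<open>whisker_left K A B C g \<theta>\<close> is \<open>g \<cdot> \<theta>\<close> for a 2-cell \<open>\<theta>\<close> between 1-cells \<open>A \<rightarrow> B\<close>
    and \<open>g: B \<rightarrow> C\<close>;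
  \<^item> \<open>whisker_right K A B C \<theta> f\<close> is \<open>\<theta> \<cdot> f\<close> for \<open>f: A \<rightarrow> B\<close> and a 2-cell \<open>\<theta>\<close> between
    1-cells \<open>B \<rightarrow> C\<close>.

  The records carry the operations only, not the equational laws; algebras, lax morphisms and lax
  idempotency are expressed through the operations.
\<close>

record ('a, 'f, 't) two_cat =
  cells0 :: "'a set"
  cells1 :: "'a \<Rightarrow> 'a \<Rightarrow> 'f set"
  cells2 :: "'a \<Rightarrow> 'a \<Rightarrow> 'f \<Rightarrow> 'f \<Rightarrow> 't set"
  id1 :: "'a \<Rightarrow> 'f"
  comp1 :: "'a \<Rightarrow> 'a \<Rightarrow> 'a \<Rightarrow> 'f \<Rightarrow> 'f \<Rightarrow> 'f"
  id2 :: "'a \<Rightarrow> 'a \<Rightarrow> 'f \<Rightarrow> 't"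
  comp2 :: "'a \<Rightarrow> 'a \<Rightarrow> 't \<Rightarrow> 't \<Rightarrow> 't"
  whisker_left :: "'a \<Rightarrow> 'a \<Rightarrow> 'a \<Rightarrow> 'f \<Rightarrow> 't \<Rightarrow> 't"
  whisker_right :: "'a \<Rightarrow> 'a \<Rightarrow> 'a \<Rightarrow> 't \<Rightarrow> 'f \<Rightarrow> 't"

record ('a, 'f, 't) two_monad =
  T0 :: "'a \<Rightarrow> 'a"
  T1 :: "'a \<Rightarrow> 'a \<Rightarrow> 'f \<Rightarrow> 'f"
  T2 :: "'a \<Rightarrow> 'a \<Rightarrow> 't \<Rightarrow> 't"
  mult :: "'a \<Rightarrow> 'f"
  unt :: "'a \<Rightarrow> 'f"

definition is_algebra ::
  "('a, 'f, 't) two_cat \<Rightarrow> ('a, 'f, 't) two_monad \<Rightarrow> 'a \<Rightarrow> 'f \<Rightarrow> bool" where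
  "is_algebra K T A a \<longleftrightarrow>
     (let TA = T0 T A; TTA = T0 T TA in
      A \<in> cells0 K \<and> a \<in> cells1 K TA A \<and>
      comp1 K TTA TA A a (T1 T TA A a) = comp1 K TTA TA A a (mult T A) \<and>
      comp1 K A TA A a (unt T A) = id1 K A)"

definition is_lax_morphism ::
  "('a, 'f, 't) two_cat \<Rightarrow> ('a, 'f, 't) two_monad \<Rightarrow>
   'a \<Rightarrow> 'f \<Rightarrow> 'a \<Rightarrow> 'f \<Rightarrow> 'f \<Rightarrow> 't \<Rightarrow> bool" where
  "is_lax_morphism K T A a B b f \<phi> \<longleftrightarrow>
     (let TA = T0 T A; TB = T0 T B; TTA = T0 T TA in
      f \<in> cells1 K A B \<and>
      \<phi> \<in> cells2 K TA B (comp1 K TA TB B b (T1 T A B f)) (comp1 K TA A B f a) \<and>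
      whisker_right K TTA TA B \<phi> (mult T A) =
        comp2 K TTA B (whisker_right K TTA TA B \<phi> (T1 T TA A a))
                      (whisker_left K TTA TB B b (T2 T TA B \<phi>)) \<and>
      whisker_right K A TA B \<phi> (unt T A) = id2 K A B f)"

definition lax_idempotent ::
  "('a, 'f, 't) two_cat \<Rightarrow> ('a, 'f, 't) two_monad \<Rightarrow> bool" where
  "lax_idempotent K T \<longleftrightarrow>
     (\<forall>A a B b f. is_algebra K T A a \<longrightarrow> is_algebra K T B b \<longrightarrow> f \<in> cells1 K A B \<longrightarrow>
        (\<exists>!\<phi>. is_lax_morphism K T A a B b f \<phi>))"

definition PD :: "('u doctrine, 'u doctrine_map, 'u \<Rightarrow> 'u) two_cat" where
  "PD = \<lparr>
     cells0 = Collect primary_doctrine,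
     cells1 = PD_1cells,
     cells2 = PD_2cells,
     id1 = (\<lambda>P. (id_functor (base P), \<lambda>A\<in>Obj (base P). \<lambda>\<alpha>\<in>carrier (fib P A). \<alpha>)),
     comp1 = (\<lambda>P Q R (G, c) (F, b). (comp_functor (base P) G F,
        \<lambda>A\<in>Obj (base P). \<lambda>\<alpha>\<in>carrier (fib P A). c (fobj F A) (b A \<alpha>))),
     id2 = (\<lambda>P R (F, b). id_nat (base P) (base R) F),
     comp2 = (\<lambda>P R \<tau> \<theta>. \<lambda>A\<in>Obj (base P). \<tau> A \<cdot>\<^bsub>base R\<^esub> \<theta> A),
     whisker_left = (\<lambda>P Q R (G, c) \<theta>. \<lambda>A\<in>Obj (base P). farr G (\<theta> A)),
     whisker_right = (\<lambda>P Q R \<theta> (F, b). \<lambda>A\<in>Obj (base P). \<theta> (fobj F A))\<rparr>"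

section \<open>The existential completion\<close>

text \<open>
  For \<open>P\<^sup>e\<close> to be again a doctrine over the universe \<open>'u\<close>, so that the existential completion is
  an operation on the 0-cells of \<^const>\<open>PD\<close>, elements of the poset reflection have to be coded
  in \<open>'u\<close>. This needs only that \<open>'u\<close> is infinite: an equivalence class of pairs is coded by the
  code of a chosen member.
\<close>

definition pair_code :: "'u::infinite \<times> 'u \<Rightarrow> 'u" where
  "pair_code = (SOME c. inj c)"

lemma inj_pair_code: "inj (pair_code :: 'u::infinite \<times> 'u \<Rightarrow> 'u)"
proof -
  include cardinal_syntax
  have "|(UNIV :: 'u set) \<times> (UNIV :: 'u set)| \<le>o |UNIV :: 'u set|"
    using card_of_Times_same_infinite[OF infinite_UNIV] ordIso_iff_ordLeq by blast
  then obtain c :: "'u \<times> 'u \<Rightarrow> 'u" where "inj c"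
    unfolding card_of_ordLeq[symmetric] by auto
  then show ?thesis
    unfolding pair_code_def by (rule someI[where P = inj])
qed

definition ec_pairs :: "'u doctrine \<Rightarrow> 'u \<Rightarrow> ('u \<times> 'u) set" where
  "ec_pairs P A = {(g, \<alpha>). is_projection (base P) g \<and> Cod (base P) g = A \<and>
     \<alpha> \<in> carrier (fib P (Dom (base P) g))}"

definition ec_le :: "'u doctrine \<Rightarrow> 'u \<times> 'u \<Rightarrow> 'u \<times> 'u \<Rightarrow> bool" where
  "ec_le P = (\<lambda>(h, \<alpha>) (f, \<gamma>). \<exists>w\<in>Hom (base P) (Dom (base P) h) (Dom (base P) f).
     f \<cdot>\<^bsub>base P\<^esub> w = h \<and> \<alpha> \<sqsubseteq>\<^bsub>fib P (Dom (base P) h)\<^esub> reidx P w \<gamma>)"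

definition ec_equiv_class :: "'u doctrine \<Rightarrow> 'u \<times> 'u \<Rightarrow> ('u \<times> 'u) set" where
  "ec_equiv_class P x = {y \<in> ec_pairs P (Cod (base P) (fst x)). ec_le P x y \<and> ec_le P y x}"

definition ec_class :: "'u::infinite doctrine \<Rightarrow> 'u \<times> 'u \<Rightarrow> 'u" where
  "ec_class P x = pair_code (SOME y. y \<in> ec_equiv_class P x)"

text \<open>
  \<open>ec_rep u\<close> is the chosen member of the equivalence class coded by \<open>u\<close>. The operations defined
  through it below do not depend on the choice of the representative.
\<close>

definition ec_rep :: "'u::infinite \<Rightarrow> 'u \<times> 'u" where
  "ec_rep = inv pair_code"

definition ec_fib :: "'u::infinite doctrine \<Rightarrow> 'u \<Rightarrow> 'u gorder" where
  "ec_fib P A = \<lparr>carrier = ec_class P ` ec_pairs P A, eq = (=),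
     le = (\<lambda>u v. \<exists>x\<in>ec_pairs P A. \<exists>y\<in>ec_pairs P A.
              u = ec_class P x \<and> v = ec_class P y \<and> ec_le P x y)\<rparr>"

definition ec_reidx :: "'u::infinite doctrine \<Rightarrow> 'u \<Rightarrow> 'u \<Rightarrow> 'u" where
  "ec_reidx P f u = (case ec_rep u of (g, \<beta>) \<Rightarrow>
     case (SOME (p, q). is_pullback (base P) f g p q) of (p, q) \<Rightarrow>
       ec_class P (p, reidx P q \<beta>))"

definition ec :: "'u::infinite doctrine \<Rightarrow> 'u doctrine"  (\<open>_\<^sup>e\<close> [1000] 1000) where
  "P\<^sup>e = \<lparr>base = base P, fib = ec_fib P, reidx = ec_reidx P\<rparr>"

definition ec_map :: "'u::infinite doctrine \<Rightarrow> 'u doctrine \<Rightarrow> 'u doctrine_map \<Rightarrow> 'u doctrine_map"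
  where
  "ec_map P R = (\<lambda>(F, b). (F, \<lambda>A\<in>Obj (base P). \<lambda>u\<in>carrier (fib (P\<^sup>e) A).
     case ec_rep u of (g, \<alpha>) \<Rightarrow> ec_class R (farr F g, b (Dom (base P) g) \<alpha>)))"

definition ec_unit :: "'u::infinite doctrine \<Rightarrow> 'u doctrine_map" where
  "ec_unit P = (id_functor (base P),
     \<lambda>A\<in>Obj (base P). \<lambda>\<alpha>\<in>carrier (fib P A). ec_class P (ident (base P) A, \<alpha>))"

text \<open>
  The value at \<open>\<alpha>\<close> of the left adjoint to reindexing along \<open>f\<close>, unspecified when there is no
  such value. Left adjoints along projections exist in \<open>P\<^sup>e\<close> and in every doctrine underlying an
  algebra for \<open>T\<^sub>e\<close>, where \<open>zeta\<close> is used.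
\<close>

definition ex_along :: "'u doctrine \<Rightarrow> 'u \<Rightarrow> 'u \<Rightarrow> 'u" where
  "ex_along Q f \<alpha> = (THE \<beta>. \<beta> \<in> carrier (fib Q (Cod (base Q) f)) \<and>
     (\<forall>\<gamma>\<in>carrier (fib Q (Cod (base Q) f)).
        \<beta> \<sqsubseteq>\<^bsub>fib Q (Cod (base Q) f)\<^esub> \<gamma> \<longleftrightarrow> \<alpha> \<sqsubseteq>\<^bsub>fib Q (Dom (base Q) f)\<^esub> reidx Q f \<gamma>))"

definition zeta :: "'u::infinite doctrine \<Rightarrow> 'u \<Rightarrow> 'u \<Rightarrow> 'u" where
  "zeta Q = (\<lambda>A\<in>Obj (base Q). \<lambda>u\<in>carrier (fib (Q\<^sup>e) A).
     case ec_rep u of (f, \<alpha>) \<Rightarrow> ex_along Q f \<alpha>)"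

definition T\<^sub>e :: "('u::infinite doctrine, 'u doctrine_map, 'u \<Rightarrow> 'u) two_monad" where
  "T\<^sub>e = \<lparr>
     T0 = ec,
     T1 = ec_map,
     T2 = (\<lambda>P R \<theta>. \<theta>),
     mult = (\<lambda>P. (id_functor (base P), zeta (P\<^sup>e))),
     unt = ec_unit\<rparr>"

end

theory Submission
  imports Defs
begin

text \<open>
  An algebra structure for the existential completion is a property of a doctrine, not extra data.
  The unit law forces the functor part of a structure 1-cell \<open>(G, a): P\<^sup>e \<rightarrow> P\<close> to be the identity
  (\<open>algebra_functor\<close>). Moreover \<open>a\<^sub>A(f, \<alpha>)\<close> has the universal property of \<open>\<exists>\<^sub>f \<alpha>\<close>, that is
  \<open>a\<^sub>A(f, \<alpha>) \<sqsubseteq> \<beta>\<close> iff \<open>\<alpha> \<sqsubseteq> P\<^sub>f \<beta>\<close> (\<open>algebra_left_adjoint\<close>). Indeed, \<open>\<alpha> \<sqsubseteq> P\<^sub>f \<beta>\<close> says that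
  \<open>f\<close> itself witnesses \<open>(f, \<alpha>) \<le> (id, \<beta>)\<close> in \<open>P\<^sup>e(A)\<close>, and \<open>a\<^sub>A\<close> is monotone with
  \<open>a\<^sub>A(id, \<beta>) = \<beta>\<close>. Conversely, the diagonal of the kernel pair of \<open>f\<close> witnesses
  \<open>(id, \<alpha>) \<le> P\<^sup>e\<^sub>f(f, \<alpha>)\<close> (\<open>ec_unit_le_reidx\<close>), whence \<open>\<alpha> \<sqsubseteq> P\<^sub>f(a\<^sub>A(f, \<alpha>))\<close> because \<open>a\<close> is
  natural. So \<open>a\<close> is \<open>zeta P\<close> (\<open>algebra_eq_zeta\<close>), and statements about arbitrary algebras reduce
  to statements about \<open>zeta\<close>.

  That \<open>id\<^sub>F\<close> is a 2-cell means \<open>\<exists>\<^bsub>Ff\<^esub> b(\<alpha>) \<sqsubseteq> b(\<exists>\<^sub>f \<alpha>)\<close>. By adjunction and naturality of \<open>b\<close>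
  this is \<open>b(\<alpha>) \<sqsubseteq> b(P\<^sub>f \<exists>\<^sub>f \<alpha>)\<close>, which holds since \<open>b\<close> is monotone (\<open>algebra_lax_inequality\<close>).
  In the laws of a lax morphism every whiskering involved is by a 1-cell over an identity functor,
  so for \<open>id\<^sub>F\<close> they only compare identities. For the same reason the unit law for \<open>\<theta>\<close> reads
  \<open>\<theta> = id\<^sub>F\<close>, which is uniqueness (\<open>lax_morphism_unique\<close>).

  Fibres of \<open>P\<^sup>e\<close> consist of codes of classes, and reindexing is computed on chosen representatives
  and chosen pullbacks. The lemmas on \<open>P\<^sup>e\<close> are therefore stated for the class of an arbitrary pair,
  and the comparison with the chosen representative is absorbed in their proofs.
\<close>

section \<open>Projections and their pullbacks\<close>

lemma HomD:
  assumes "f \<in> Hom C A B"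
  shows "f \<in> Arr C" and "Dom C f = A" and "Cod C f = B"
  using assms by (auto simp: Hom_def)

lemma (in category) Hom_Obj:
  assumes "f \<in> Hom C A B"
  shows "A \<in> Obj C" and "B \<in> Obj C"
  using assms Dom_in_Obj Cod_in_Obj by (auto simp: Hom_def)

lemma is_product_eqI:
  assumes "is_product C X A B p q" and "category C"
    and "h \<in> Hom C Y X" "k \<in> Hom C Y X"
    and "p \<cdot>\<^bsub>C\<^esub> h = p \<cdot>\<^bsub>C\<^esub> k" "q \<cdot>\<^bsub>C\<^esub> h = q \<cdot>\<^bsub>C\<^esub> k"
  shows "h = k"
proof -
  interpret category C by fact
  have pq: "p \<in> Hom C X A" "q \<in> Hom C X B"
    using assms(1) by (auto simp: is_product_def)
  have "\<exists>!h. h \<in> Hom C Y X \<and> p \<cdot>\<^bsub>C\<^esub> h = p \<cdot>\<^bsub>C\<^esub> k \<and> q \<cdot>\<^bsub>C\<^esub> h = q \<cdot>\<^bsub>C\<^esub> k"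
    using assms(1) Hom_Obj(1)[OF assms(4)] Comp_in_Hom[OF assms(4) pq(1)]
      Comp_in_Hom[OF assms(4) pq(2)]
    unfolding is_product_def by blast
  then show ?thesis using assms(3-6) by blast
qed

lemma is_product_lift:
  assumes "is_product C X A B p q" and "category C"
    and "f \<in> Hom C Y A" "g \<in> Hom C Y B"
  obtains h where "h \<in> Hom C Y X" "p \<cdot>\<^bsub>C\<^esub> h = f" "q \<cdot>\<^bsub>C\<^esub> h = g"
proof -
  have "Y \<in> Obj C" using category.Hom_Obj(1)[OF assms(2,3)] .
  then show ?thesis using assms(1,3,4) that unfolding is_product_def by blast
qed

lemma is_projection_Arr: "is_projection C p \<Longrightarrow> p \<in> Arr C"
  by (auto simp: is_projection_def is_product_def Hom_def)

text \<open>An object is its own product with a terminal object.\<close>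

lemma (in fp_category) is_projection_ident:
  assumes "A \<in> Obj C"
  shows "is_projection C (ident C A)"
proof -
  obtain T where T: "is_terminal C T" using terminal_exists by blast
  then obtain t where t: "t \<in> Hom C A T" using assms unfolding is_terminal_def by blast
  have "is_product C A A T (ident C A) t"
    unfolding is_product_def
  proof (intro conjI ballI)
    fix Y f g assume Y: "Y \<in> Obj C" and f: "f \<in> Hom C Y A" and g: "g \<in> Hom C Y T"
    have "t \<cdot> f = g"
      using Comp_in_Hom[OF f t] g T Y unfolding is_terminal_def by blast
    then show "\<exists>!h. h \<in> Hom C Y A \<and> ident C A \<cdot> h = f \<and> t \<cdot> h = g"
      using f ident_Comp by metis
  qed (use assms ident_in_Hom t in auto)
  then show ?thesis unfolding is_projection_def by blast
qed

text \<open>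
  If \<open>g\<close> is the first leg of \<open>X = A \<times> B\<close>, then a pullback of \<open>g\<close> along
  \<open>f: A' \<rightarrow> A\<close> is a product \<open>A' \<times> B\<close>: an arrow into \<open>X\<close> lying over \<open>f\<close> is
  determined by, and can have any, component in \<open>B\<close>. Hence every pullback of a projection is a
  projection and, conversely, a pullback exists because a product does.
\<close>

lemma (in category) is_projection_pullback:
  assumes g: "is_projection C g" and f: "f \<in> Arr C" "Cod C f = Cod C g"
    and pb: "is_pullback C f g p q"
  shows "is_projection C p"
proof -
  obtain X A B e where P: "is_product C X A B g e" using g is_projection_def by metis
  then have gH: "g \<in> Hom C X A" and eH: "e \<in> Hom C X B" by (auto simp: is_product_def)
  have fH: "f \<in> Hom C (Dom C f) A" using f HomD(3)[OF gH] by (simp add: Hom_def)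
  have pH: "p \<in> Hom C (Dom C p) (Dom C f)" and qH: "q \<in> Hom C (Dom C p) X"
    and comm: "f \<cdot> p = g \<cdot> q"
    using pb HomD(2)[OF gH] by (auto simp: is_pullback_def)
  have "is_product C (Dom C p) (Dom C f) B p (e \<cdot> q)"
    unfolding is_product_def
  proof (intro conjI ballI)
    fix Y r s assume Y: "Y \<in> Obj C" and r: "r \<in> Hom C Y (Dom C f)" and s: "s \<in> Hom C Y B"
    obtain t where t: "t \<in> Hom C Y X" "g \<cdot> t = f \<cdot> r" "e \<cdot> t = s"
      using is_product_lift[OF P category_axioms Comp_in_Hom[OF r fH] s] by metis
    have ex1: "\<exists>!h. h \<in> Hom C Y (Dom C p) \<and> p \<cdot> h = r \<and> q \<cdot> h = t"
      using pb Y r t HomD(2)[OF gH] unfolding is_pullback_def by metis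
    then obtain h where h: "h \<in> Hom C Y (Dom C p)" "p \<cdot> h = r" "q \<cdot> h = t" by blast
    show "\<exists>!h. h \<in> Hom C Y (Dom C p) \<and> p \<cdot> h = r \<and> (e \<cdot> q) \<cdot> h = s"
    proof (rule ex1I[of _ h])
      show "h \<in> Hom C Y (Dom C p) \<and> p \<cdot> h = r \<and> (e \<cdot> q) \<cdot> h = s"
        using h t Comp_assoc[OF h(1) qH eH] by simp
      fix k assume k: "k \<in> Hom C Y (Dom C p) \<and> p \<cdot> k = r \<and> (e \<cdot> q) \<cdot> k = s"
      then have kH: "k \<in> Hom C Y (Dom C p)" by simp
      have "q \<cdot> k = t"
      proof (rule is_product_eqI[OF P category_axioms Comp_in_Hom[OF kH qH] t(1)])
        show "g \<cdot> (q \<cdot> k) = g \<cdot> t"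
          using Comp_assoc[OF kH qH gH] Comp_assoc[OF kH pH fH] comm k t by simp
        show "e \<cdot> (q \<cdot> k) = e \<cdot> t"
          using Comp_assoc[OF kH qH eH] k t by simp
      qed
      with k h ex1 show "k = h" by blast
    qed
  qed (use pH Comp_in_Hom[OF qH eH] in auto)
  then show ?thesis unfolding is_projection_def by blast
qed

lemma (in fp_category) pullback_of_projection_exists:
  assumes g: "is_projection C g" and f: "f \<in> Arr C" "Cod C f = Cod C g"
  shows "\<exists>p q. is_pullback C f g p q"
proof -
  obtain X A B e where P: "is_product C X A B g e" using g is_projection_def by metis
  then have gH: "g \<in> Hom C X A" and eH: "e \<in> Hom C X B" by (auto simp: is_product_def)
  have fH: "f \<in> Hom C (Dom C f) A" using f HomD(3)[OF gH] by (simp add: Hom_def)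
  obtain Z p d where Q: "is_product C Z (Dom C f) B p d"
    using product_exists[OF Hom_Obj(1)[OF fH] Hom_Obj(2)[OF eH]] by blast
  then have pH: "p \<in> Hom C Z (Dom C f)" and dH: "d \<in> Hom C Z B" by (auto simp: is_product_def)
  obtain q where q: "q \<in> Hom C Z X" "g \<cdot> q = f \<cdot> p" "e \<cdot> q = d"
    using is_product_lift[OF P category_axioms Comp_in_Hom[OF pH fH] dH] by metis
  have "is_pullback C f g p q"
    unfolding is_pullback_def HomD(2)[OF gH] HomD(2)[OF pH]
  proof (intro conjI ballI impI)
    fix Y r s assume r: "r \<in> Hom C Y (Dom C f)" and s: "s \<in> Hom C Y X"
      and rs: "f \<cdot> r = g \<cdot> s"
    obtain h where h: "h \<in> Hom C Y Z" "p \<cdot> h = r" "d \<cdot> h = e \<cdot> s"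
      using is_product_lift[OF Q category_axioms r Comp_in_Hom[OF s eH]] by metis
    show "\<exists>!h. h \<in> Hom C Y Z \<and> p \<cdot> h = r \<and> q \<cdot> h = s"
    proof (rule ex1I[of _ h])
      have "q \<cdot> h = s"
      proof (rule is_product_eqI[OF P category_axioms Comp_in_Hom[OF h(1) q(1)] s])
        show "g \<cdot> (q \<cdot> h) = g \<cdot> s"
          using Comp_assoc[OF h(1) q(1) gH] Comp_assoc[OF h(1) pH fH] q h rs by simp
        show "e \<cdot> (q \<cdot> h) = e \<cdot> s"
          using Comp_assoc[OF h(1) q(1) eH] q h by simp
      qed
      with h show "h \<in> Hom C Y Z \<and> p \<cdot> h = r \<and> q \<cdot> h = s" by simp
      fix k assume k: "k \<in> Hom C Y Z \<and> p \<cdot> k = r \<and> q \<cdot> k = s"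
      then have kH: "k \<in> Hom C Y Z" by simp
      show "k = h"
      proof (rule is_product_eqI[OF Q category_axioms kH h(1)])
        show "p \<cdot> k = p \<cdot> h" using k h by simp
        show "d \<cdot> k = d \<cdot> h" using Comp_assoc[OF kH q(1) eH] q k h by simp
      qed
    qed
  qed (use pH q in auto)
  then show ?thesis by blast
qed

lemma preserves_finite_products_projection:
  assumes "preserves_finite_products C D F" and "is_projection C g"
  shows "is_projection D (farr F g)"
  using assms unfolding preserves_finite_products_def is_projection_def by metis


section \<open>Monotonicity\<close>

text \<open>
  A map preserving binary meets is monotone because \<open>x \<sqsubseteq> y\<close> makes \<open>x\<close> the meet of \<open>x\<close> and
  \<open>y\<close>. Taking a mere partial order as the domain makes this applicable to the fibres of
  \<open>P\<^sup>e\<close> before anything is known about their meets.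
\<close>

lemma inf_semilattice_hom_mono:
  assumes h: "inf_semilattice_hom L M h" and L: "partial_order L" and M: "inf_semilattice M"
    and x: "x \<in> carrier L" and y: "y \<in> carrier L" and le: "x \<sqsubseteq>\<^bsub>L\<^esub> y"
  shows "h x \<sqsubseteq>\<^bsub>M\<^esub> h y"
proof -
  interpret L: partial_order L by fact
  interpret M: inf_semilattice M by fact
  have glb: "greatest L x (Lower L {x, y})"
    using x y le by (auto simp: greatest_def Lower_def)
  have "x \<sqinter>\<^bsub>L\<^esub> y = x"
    unfolding meet_def inf_def by (rule some_equality) (use glb L.greatest_unique in auto)
  moreover have "h (x \<sqinter>\<^bsub>L\<^esub> y) = h x \<sqinter>\<^bsub>M\<^esub> h y" and "h x \<in> carrier M" "h y \<in> carrier M"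
    using h x y by (auto simp: inf_semilattice_hom_def)
  ultimately show ?thesis using M.meet_right by metis
qed

lemma inf_semilattice_partial_order: "inf_semilattice L \<Longrightarrow> partial_order L"
  by (simp add: inf_semilattice_def lower_semilattice_def)

sublocale primary_doctrine \<subseteq> base: fp_category "base P"
  by (rule base_fp)

context primary_doctrine
begin

lemma fib_le_refl:
  assumes "A \<in> Obj (base P)" "\<alpha> \<in> carrier (fib P A)"
  shows "\<alpha> \<sqsubseteq>\<^bsub>fib P A\<^esub> \<alpha>"
proof -
  interpret partial_order "fib P A"
    using assms(1) by (intro inf_semilattice_partial_order fib_inf_semilattice)
  show ?thesis using assms le_refl by blast
qed

lemma fib_le_trans:
  assumes "A \<in> Obj (base P)"
    and "\<alpha> \<sqsubseteq>\<^bsub>fib P A\<^esub> \<beta>" "\<beta> \<sqsubseteq>\<^bsub>fib P A\<^esub> \<gamma>"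
    and "\<alpha> \<in> carrier (fib P A)" "\<beta> \<in> carrier (fib P A)" "\<gamma> \<in> carrier (fib P A)"
  shows "\<alpha> \<sqsubseteq>\<^bsub>fib P A\<^esub> \<gamma>"
proof -
  interpret partial_order "fib P A"
    using assms(1) by (intro inf_semilattice_partial_order fib_inf_semilattice)
  show ?thesis using assms le_trans by blast
qed

lemma fib_le_antisym:
  assumes "A \<in> Obj (base P)"
    and "\<alpha> \<sqsubseteq>\<^bsub>fib P A\<^esub> \<beta>" "\<beta> \<sqsubseteq>\<^bsub>fib P A\<^esub> \<alpha>"
    and "\<alpha> \<in> carrier (fib P A)" "\<beta> \<in> carrier (fib P A)"
  shows "\<alpha> = \<beta>"
proof -
  interpret partial_order "fib P A"
    using assms(1) by (intro inf_semilattice_partial_order fib_inf_semilattice)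
  show ?thesis using assms le_antisym by blast
qed

lemma reidx_closed:
  "\<lbrakk>f \<in> Hom (base P) A B; \<beta> \<in> carrier (fib P B)\<rbrakk> \<Longrightarrow> reidx P f \<beta> \<in> carrier (fib P A)"
  using reidx_hom[of f A B] by (auto simp: inf_semilattice_hom_def)

lemma reidx_mono:
  assumes "f \<in> Hom (base P) A B" "\<alpha> \<sqsubseteq>\<^bsub>fib P B\<^esub> \<beta>"
    and "\<alpha> \<in> carrier (fib P B)" "\<beta> \<in> carrier (fib P B)"
  shows "reidx P f \<alpha> \<sqsubseteq>\<^bsub>fib P A\<^esub> reidx P f \<beta>"
  using inf_semilattice_hom_mono reidx_hom[OF assms(1)] assms base.Hom_Obj[OF assms(1)]
    fib_inf_semilattice inf_semilattice_partial_order by metis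


section \<open>Fibres of the existential completion\<close>

lemma ec_pairsD:
  assumes "(g, \<alpha>) \<in> ec_pairs P A"
  shows "g \<in> Hom (base P) (Dom (base P) g) A" and "is_projection (base P) g"
    and "\<alpha> \<in> carrier (fib P (Dom (base P) g))"
    and "Dom (base P) g \<in> Obj (base P)" and "A \<in> Obj (base P)"
  using assms is_projection_Arr[of "base P" g] base.Dom_in_Obj base.Cod_in_Obj
  by (auto simp: ec_pairs_def Hom_def)

lemma ec_le_refl:
  assumes "x \<in> ec_pairs P A"
  shows "ec_le P x x"
proof -
  obtain g \<alpha> where x: "x = (g, \<alpha>)" by (cases x)
  note g = ec_pairsD[OF assms[unfolded x]]
  have "reidx P (ident (base P) (Dom (base P) g)) \<alpha> = \<alpha>" using g reidx_ident by simp
  then show ?thesis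
    unfolding ec_le_def x
    using base.ident_in_Hom[OF g(4)] base.Comp_ident[OF g(1)] fib_le_refl[OF g(4,3)]
    by (auto intro: bexI[of _ "ident (base P) (Dom (base P) g)"])
qed

lemma ec_le_trans:
  assumes "x \<in> ec_pairs P A" "y \<in> ec_pairs P A" "z \<in> ec_pairs P A"
    and "ec_le P x y" "ec_le P y z"
  shows "ec_le P x z"
proof -
  obtain f \<alpha> g \<beta> h \<gamma> where xyz: "x = (f, \<alpha>)" "y = (g, \<beta>)" "z = (h, \<gamma>)"
    by (cases x, cases y, cases z)
  note f = ec_pairsD[OF assms(1)[unfolded xyz]] and g = ec_pairsD[OF assms(2)[unfolded xyz]]
    and h = ec_pairsD[OF assms(3)[unfolded xyz]]
  obtain v where v: "v \<in> Hom (base P) (Dom (base P) f) (Dom (base P) g)"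
      "g \<cdot>\<^bsub>base P\<^esub> v = f" "\<alpha> \<sqsubseteq>\<^bsub>fib P (Dom (base P) f)\<^esub> reidx P v \<beta>"
    using assms(4) xyz by (auto simp: ec_le_def)
  obtain w where w: "w \<in> Hom (base P) (Dom (base P) g) (Dom (base P) h)"
      "h \<cdot>\<^bsub>base P\<^esub> w = g" "\<beta> \<sqsubseteq>\<^bsub>fib P (Dom (base P) g)\<^esub> reidx P w \<gamma>"
    using assms(5) xyz by (auto simp: ec_le_def)
  have w\<gamma>: "reidx P w \<gamma> \<in> carrier (fib P (Dom (base P) g))" using w h reidx_closed by blast
  have "reidx P v \<beta> \<sqsubseteq>\<^bsub>fib P (Dom (base P) f)\<^esub> reidx P v (reidx P w \<gamma>)"
    using reidx_mono v w w\<gamma> g by blast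
  then have "\<alpha> \<sqsubseteq>\<^bsub>fib P (Dom (base P) f)\<^esub> reidx P v (reidx P w \<gamma>)"
    using fib_le_trans[OF f(4) v(3)] f reidx_closed[OF v(1)] g w\<gamma> by blast
  then have "\<alpha> \<sqsubseteq>\<^bsub>fib P (Dom (base P) f)\<^esub> reidx P (w \<cdot>\<^bsub>base P\<^esub> v) \<gamma>"
    using reidx_Comp[OF v(1) w(1)] h by simp
  moreover have "h \<cdot>\<^bsub>base P\<^esub> (w \<cdot>\<^bsub>base P\<^esub> v) = f"
    using base.Comp_assoc[OF v(1) w(1) h(1)] v w by simp
  ultimately show ?thesis
    unfolding ec_le_def xyz using base.Comp_in_Hom[OF v(1) w(1)] by auto
qed

end

context
  fixes P :: "'u::infinite doctrine"
  assumes P: "primary_doctrine P"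
begin

interpretation primary_doctrine P by (rule P)

lemma ec_equiv_class_iff:
  assumes "x \<in> ec_pairs P A"
  shows "y \<in> ec_equiv_class P x \<longleftrightarrow> y \<in> ec_pairs P A \<and> ec_le P x y \<and> ec_le P y x"
  using assms by (auto simp: ec_equiv_class_def ec_pairs_def)

lemma ec_rep_ec_class:
  assumes "x \<in> ec_pairs P A"
  shows "ec_rep (ec_class P x) \<in> ec_equiv_class P x"
proof -
  have "ec_rep (ec_class P x) = (SOME y. y \<in> ec_equiv_class P x)"
    unfolding ec_rep_def ec_class_def by (rule inv_f_f[OF inj_pair_code])
  moreover have "x \<in> ec_equiv_class P x"
    using ec_equiv_class_iff[OF assms] assms ec_le_refl by blast
  ultimately show ?thesis by (metis someI)
qed

lemma ec_class_eq_iff: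
  assumes x: "x \<in> ec_pairs P A" and y: "y \<in> ec_pairs P A"
  shows "ec_class P x = ec_class P y \<longleftrightarrow> ec_le P x y \<and> ec_le P y x"
proof
  assume "ec_class P x = ec_class P y"
  then obtain z where "z \<in> ec_equiv_class P x" "z \<in> ec_equiv_class P y"
    using ec_rep_ec_class[OF x] ec_rep_ec_class[OF y] by metis
  then show "ec_le P x y \<and> ec_le P y x"
    using ec_equiv_class_iff[OF x] ec_equiv_class_iff[OF y] ec_le_trans x y by metis
next
  assume "ec_le P x y \<and> ec_le P y x"
  then have "ec_equiv_class P x = ec_equiv_class P y"
    using ec_equiv_class_iff[OF x] ec_equiv_class_iff[OF y] ec_le_trans x y by blast
  then show "ec_class P x = ec_class P y" by (simp add: ec_class_def)
qed

lemma ec_class_in_carrier: "x \<in> ec_pairs P A \<Longrightarrow> ec_class P x \<in> carrier (ec_fib P A)"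
  by (simp add: ec_fib_def)

lemma ec_rep_in_pairs:
  assumes "u \<in> carrier (ec_fib P A)"
  shows "ec_rep u \<in> ec_pairs P A" and "ec_class P (ec_rep u) = u"
proof -
  obtain x where x: "x \<in> ec_pairs P A" "u = ec_class P x"
    using assms by (auto simp: ec_fib_def)
  have rep: "ec_rep u \<in> ec_pairs P A" "ec_le P x (ec_rep u)" "ec_le P (ec_rep u) x"
    using ec_rep_ec_class[OF x(1)] ec_equiv_class_iff[OF x(1)] x(2) by auto
  then show "ec_rep u \<in> ec_pairs P A" "ec_class P (ec_rep u) = u"
    using ec_class_eq_iff[OF rep(1) x(1)] x(2) by auto
qed

lemma ec_fib_le_iff:
  assumes x: "x \<in> ec_pairs P A" and y: "y \<in> ec_pairs P A"
  shows "ec_class P x \<sqsubseteq>\<^bsub>ec_fib P A\<^esub> ec_class P y \<longleftrightarrow> ec_le P x y"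
proof
  assume "ec_class P x \<sqsubseteq>\<^bsub>ec_fib P A\<^esub> ec_class P y"
  then obtain x' y' where "x' \<in> ec_pairs P A" "y' \<in> ec_pairs P A"
    "ec_class P x = ec_class P x'" "ec_class P y = ec_class P y'" "ec_le P x' y'"
    by (auto simp: ec_fib_def)
  then show "ec_le P x y" using ec_class_eq_iff x y ec_le_trans by metis
next
  assume "ec_le P x y"
  then show "ec_class P x \<sqsubseteq>\<^bsub>ec_fib P A\<^esub> ec_class P y" using x y by (auto simp: ec_fib_def)
qed

lemma ec_fib_partial_order: "partial_order (ec_fib P A)"
proof -
  have eq: "(.=\<^bsub>ec_fib P A\<^esub>) = (=)" by (simp add: ec_fib_def)
  have car: "\<exists>x\<in>ec_pairs P A. u = ec_class P x" if "u \<in> carrier (ec_fib P A)" for u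
    using that by (auto simp: ec_fib_def)
  show ?thesis
  proof (unfold_locales, unfold eq)
    fix u v w
    assume u: "u \<in> carrier (ec_fib P A)"
    then obtain x where x: "x \<in> ec_pairs P A" "u = ec_class P x" using car by blast
    then show "u \<sqsubseteq>\<^bsub>ec_fib P A\<^esub> u" using ec_fib_le_iff ec_le_refl by simp
    assume v: "v \<in> carrier (ec_fib P A)" and uv: "u \<sqsubseteq>\<^bsub>ec_fib P A\<^esub> v"
    obtain y where y: "y \<in> ec_pairs P A" "v = ec_class P y" using car v by blast
    have xy: "ec_le P x y" using x y uv ec_fib_le_iff by simp
    show "u = v" if "v \<sqsubseteq>\<^bsub>ec_fib P A\<^esub> u"
      using that x y xy ec_fib_le_iff ec_class_eq_iff by simp
    assume w: "w \<in> carrier (ec_fib P A)" and vw: "v \<sqsubseteq>\<^bsub>ec_fib P A\<^esub> w"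
    obtain z where z: "z \<in> ec_pairs P A" "w = ec_class P z" using car w by blast
    show "u \<sqsubseteq>\<^bsub>ec_fib P A\<^esub> w"
      using x y z xy vw ec_fib_le_iff ec_le_trans by metis
  qed auto
qed

lemma ec_unit_pair:
  assumes "A \<in> Obj (base P)" "\<alpha> \<in> carrier (fib P A)"
  shows "(ident (base P) A, \<alpha>) \<in> ec_pairs P A"
  using assms base.is_projection_ident HomD[OF base.ident_in_Hom[OF assms(1)]]
  by (simp add: ec_pairs_def)

text \<open>
  The unit of the adjunction between \<open>\<exists>\<^sup>e\<^sub>f\<close> and reindexing along a projection \<open>f\<close>. The witness is
  the arrow from the domain of \<open>f\<close> into the pullback induced by the identity and the comparison
  \<open>w\<close> of \<open>f\<close> with the chosen representative \<open>(f', \<alpha>')\<close>; for \<open>f' = f\<close> and \<open>w\<close> an identity it is the diagonal of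
  the kernel pair of \<open>f\<close>.
\<close>

lemma ec_unit_le_reidx:
  assumes x: "(f, \<alpha>) \<in> ec_pairs P A"
  shows "ec_reidx P f (ec_class P (f, \<alpha>)) \<in> carrier (ec_fib P (Dom (base P) f))"
    and "ec_class P (ident (base P) (Dom (base P) f), \<alpha>) \<sqsubseteq>\<^bsub>ec_fib P (Dom (base P) f)\<^esub>
      ec_reidx P f (ec_class P (f, \<alpha>))"
proof -
  let ?C = "base P" and ?X = "Dom (base P) f"
  obtain f' \<alpha>' where rep: "ec_rep (ec_class P (f, \<alpha>)) = (f', \<alpha>')" by fastforce
  have x': "(f', \<alpha>') \<in> ec_pairs P A" and le: "ec_le P (f, \<alpha>) (f', \<alpha>')"
    using ec_rep_ec_class[OF x] ec_equiv_class_iff[OF x] rep by auto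
  note f = ec_pairsD[OF x] and f' = ec_pairsD[OF x']
  have cod: "Cod ?C f = Cod ?C f'" and fA: "f \<in> Arr ?C" using f f' by (auto dest: HomD)
  obtain p q where some: "(SOME (p, q). is_pullback ?C f f' p q) = (p, q)" by fastforce
  have pb: "is_pullback ?C f f' p q"
    using someI_ex[of "\<lambda>(p, q). is_pullback ?C f f' p q"] some
      base.pullback_of_projection_exists[OF f'(2) fA cod] by auto
  have pP: "is_projection ?C p" using base.is_projection_pullback[OF f'(2) fA cod pb] .
  have pH: "p \<in> Hom ?C (Dom ?C p) ?X" and qH: "q \<in> Hom ?C (Dom ?C p) (Dom ?C f')"
    using pb by (auto simp: is_pullback_def)
  have val: "ec_reidx P f (ec_class P (f, \<alpha>)) = ec_class P (p, reidx P q \<alpha>')"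
    unfolding ec_reidx_def rep by (simp add: some)
  have pair: "(p, reidx P q \<alpha>') \<in> ec_pairs P ?X"
    using pP HomD(3)[OF pH] reidx_closed[OF qH f'(3)] by (simp add: ec_pairs_def)
  then show "ec_reidx P f (ec_class P (f, \<alpha>)) \<in> carrier (ec_fib P ?X)"
    unfolding val by (rule ec_class_in_carrier)
  have idX: "ident ?C ?X \<in> Hom ?C ?X ?X" using base.ident_in_Hom f by blast
  obtain w where w: "w \<in> Hom ?C ?X (Dom ?C f')" "f' \<cdot>\<^bsub>?C\<^esub> w = f"
      "\<alpha> \<sqsubseteq>\<^bsub>fib P ?X\<^esub> reidx P w \<alpha>'"
    using le by (auto simp: ec_le_def)
  have "f \<cdot>\<^bsub>?C\<^esub> ident ?C ?X = f' \<cdot>\<^bsub>?C\<^esub> w" using w base.Comp_ident[OF f(1)] by simp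
  then obtain h where h: "h \<in> Hom ?C ?X (Dom ?C p)" "p \<cdot>\<^bsub>?C\<^esub> h = ident ?C ?X"
      "q \<cdot>\<^bsub>?C\<^esub> h = w"
    using pb idX w(1) f(4) unfolding is_pullback_def by blast
  have "reidx P h (reidx P q \<alpha>') = reidx P w \<alpha>'"
    using reidx_Comp[OF h(1) qH f'(3)] h by simp
  then have "ec_le P (ident ?C ?X, \<alpha>) (p, reidx P q \<alpha>')"
    using h w HomD(2)[OF idX] by (auto simp: ec_le_def)
  then show "ec_class P (ident ?C ?X, \<alpha>) \<sqsubseteq>\<^bsub>ec_fib P ?X\<^esub> ec_reidx P f (ec_class P (f, \<alpha>))"
    unfolding val using ec_fib_le_iff[OF ec_unit_pair pair] f by blast
qed

end


section \<open>Algebras\<close>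

lemma base_ec [simp]: "base (P\<^sup>e) = base P"
  and fib_ec [simp]: "fib (P\<^sup>e) = ec_fib P"
  and reidx_ec [simp]: "reidx (P\<^sup>e) = ec_reidx P"
  by (simp_all add: ec_def)

lemma cells_PD [simp]:
  "cells0 PD = Collect primary_doctrine" "cells1 PD = PD_1cells" "cells2 PD = PD_2cells"
  and ops_PD [simp]:
  "id1 PD P = (id_functor (base P), \<lambda>A\<in>Obj (base P). \<lambda>\<alpha>\<in>carrier (fib P A). \<alpha>)"
  "comp1 PD P Q R (G, c) (F, b) = (comp_functor (base P) G F,
     \<lambda>A\<in>Obj (base P). \<lambda>\<alpha>\<in>carrier (fib P A). c (fobj F A) (b A \<alpha>))"
  "id2 PD P R (F, b) = id_nat (base P) (base R) F"
  "comp2 PD P R \<tau> \<theta> = (\<lambda>A\<in>Obj (base P). \<tau> A \<cdot>\<^bsub>base R\<^esub> \<theta> A)"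
  "whisker_left PD P Q R (G, c) \<theta> = (\<lambda>A\<in>Obj (base P). farr G (\<theta> A))"
  "whisker_right PD P Q R \<theta> (F, b) = (\<lambda>A\<in>Obj (base P). \<theta> (fobj F A))"
  by (simp_all add: PD_def)

lemma T\<^sub>e_simps [simp]:
  "T0 T\<^sub>e = ec" "T1 T\<^sub>e = ec_map" "T2 T\<^sub>e P R \<theta> = \<theta>" "unt T\<^sub>e = ec_unit"
  "mult T\<^sub>e P = (id_functor (base P), zeta (P\<^sup>e))"
  by (simp_all add: T\<^sub>e_def)

lemma fobj_id_functor [simp]: "A \<in> Obj C \<Longrightarrow> fobj (id_functor C) A = A"
  and farr_id_functor [simp]: "f \<in> Arr C \<Longrightarrow> farr (id_functor C) f = f"
  by (simp_all add: id_functor_def)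

lemma comp_functor_ident:
  assumes "is_functor C D F"
  shows "comp_functor C F (id_functor C) = F"
  using assms
  by (auto simp: comp_functor_def id_functor_def is_functor_def intro!: cat_functor.equality
      ext dest: PiE_arb)

lemma ident_comp_functor:
  assumes "is_functor C D F"
  shows "comp_functor C (id_functor D) F = F"
  using assms
  by (auto simp: comp_functor_def id_functor_def is_functor_def intro!: cat_functor.equality
      ext dest: PiE_arb PiE_mem)

lemma is_algebraD:
  assumes "is_algebra PD T\<^sub>e P (G, a)"
  shows "primary_doctrine P" and "(G, a) \<in> PD_1cells (P\<^sup>e) P"
    and "comp_functor (base P) G (id_functor (base P)) = id_functor (base P)"
    and "\<lbrakk>A \<in> Obj (base P); \<alpha> \<in> carrier (fib P A)\<rbrakk>
      \<Longrightarrow> a A (ec_class P (ident (base P) A, \<alpha>)) = \<alpha>"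
proof -
  show "primary_doctrine P" "(G, a) \<in> PD_1cells (P\<^sup>e) P"
    using assms by (simp_all add: is_algebra_def Let_def)
  have unit: "comp_functor (base P) G (id_functor (base P)) = id_functor (base P)"
    "(\<lambda>A\<in>Obj (base P). \<lambda>\<alpha>\<in>carrier (fib P A). a (fobj (id_functor (base P)) A)
        ((\<lambda>A\<in>Obj (base P). \<lambda>\<alpha>\<in>carrier (fib P A). ec_class P (ident (base P) A, \<alpha>)) A \<alpha>))
      = (\<lambda>A\<in>Obj (base P). \<lambda>\<alpha>\<in>carrier (fib P A). \<alpha>)"
    using assms by (simp_all add: is_algebra_def Let_def ec_unit_def)
  show "comp_functor (base P) G (id_functor (base P)) = id_functor (base P)" by (rule unit)
  assume "A \<in> Obj (base P)" "\<alpha> \<in> carrier (fib P A)"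
  then show "a A (ec_class P (ident (base P) A, \<alpha>)) = \<alpha>"
    using fun_cong[OF fun_cong[OF unit(2), of A], of \<alpha>] by (simp add: id_functor_def)
qed

lemma algebra_functor:
  assumes "is_algebra PD T\<^sub>e P (G, a)"
  shows "G = id_functor (base P)"
proof -
  have "is_functor (base P) (base P) G"
    using is_algebraD(2)[OF assms] by (simp add: PD_1cells_def)
  then show ?thesis using is_algebraD(3)[OF assms] comp_functor_ident by metis
qed

lemma algebra_closed:
  assumes "is_algebra PD T\<^sub>e P (G, a)" "A \<in> Obj (base P)" "u \<in> carrier (ec_fib P A)"
  shows "a A u \<in> carrier (fib P A)"
  using is_algebraD(2)[OF assms(1)] assms algebra_functor[OF assms(1)]
  by (auto simp: PD_1cells_def inf_semilattice_hom_def id_functor_def)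

text \<open>
  The structure map of any algebra supplies the left adjoints along projections. By the unit law it
  sends \<open>(id, \<alpha>)\<close> to \<open>\<alpha>\<close>, so by monotonicity and naturality it carries the unit inequality of
  \<open>P\<^sup>e\<close> to one in \<open>P\<close>, and the inequality \<open>(f, \<alpha>) \<le> (id, \<beta>)\<close> to \<open>a\<^sub>A(f, \<alpha>) \<sqsubseteq> \<beta>\<close>.
\<close>

lemma algebra_left_adjoint:
  assumes alg: "is_algebra PD T\<^sub>e P (G, a)"
    and x: "(f, \<alpha>) \<in> ec_pairs P A" and \<beta>: "\<beta> \<in> carrier (fib P A)"
  shows "a A (ec_class P (f, \<alpha>)) \<sqsubseteq>\<^bsub>fib P A\<^esub> \<beta> \<longleftrightarrow>
    \<alpha> \<sqsubseteq>\<^bsub>fib P (Dom (base P) f)\<^esub> reidx P f \<beta>"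
proof -
  note P = is_algebraD(1)[OF alg]
  interpret primary_doctrine P by (rule P)
  let ?X = "Dom (base P) f"
  note f = ec_pairsD[OF x] and unit = is_algebraD(4)[OF alg]
  note cl = ec_class_in_carrier[OF P]
  have hom: "inf_semilattice_hom (ec_fib P B) (fib P B) (a B)" if "B \<in> Obj (base P)" for B
    using is_algebraD(2)[OF alg] that algebra_functor[OF alg]
    by (simp add: PD_1cells_def id_functor_def)
  note mono = inf_semilattice_hom_mono[OF hom ec_fib_partial_order[OF P] fib_inf_semilattice]
  have nat: "a B (ec_reidx P g u) = reidx P g (a C u)"
    if "g \<in> Hom (base P) B C" "u \<in> carrier (ec_fib P C)" for g B C u
    using is_algebraD(2)[OF alg] that algebra_functor[OF alg] HomD(1)[OF that(1)]
    by (auto simp: PD_1cells_def id_functor_def)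
  have aX: "a A (ec_class P (f, \<alpha>)) \<in> carrier (fib P A)"
    using algebra_closed[OF alg f(5) cl[OF x]] .
  show ?thesis
  proof
    assume le: "a A (ec_class P (f, \<alpha>)) \<sqsubseteq>\<^bsub>fib P A\<^esub> \<beta>"
    have "a ?X (ec_class P (ident (base P) ?X, \<alpha>)) \<sqsubseteq>\<^bsub>fib P ?X\<^esub>
        a ?X (ec_reidx P f (ec_class P (f, \<alpha>)))"
      using mono[OF f(4,4) cl[OF ec_unit_pair[OF P f(4,3)]]] ec_unit_le_reidx[OF P x] by blast
    then have "\<alpha> \<sqsubseteq>\<^bsub>fib P ?X\<^esub> reidx P f (a A (ec_class P (f, \<alpha>)))"
      using unit[OF f(4,3)] nat[OF f(1) cl[OF x]] by simp
    then show "\<alpha> \<sqsubseteq>\<^bsub>fib P ?X\<^esub> reidx P f \<beta>"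
      using fib_le_trans[OF f(4) _ reidx_mono[OF f(1) le aX \<beta>] f(3)
          reidx_closed[OF f(1) aX] reidx_closed[OF f(1) \<beta>]] by simp
  next
    assume "\<alpha> \<sqsubseteq>\<^bsub>fib P ?X\<^esub> reidx P f \<beta>"
    then have "ec_le P (f, \<alpha>) (ident (base P) A, \<beta>)"
      using f base.ident_Comp[OF f(1)] HomD(2)[OF base.ident_in_Hom[OF f(5)]]
      by (auto simp: ec_le_def)
    then have "a A (ec_class P (f, \<alpha>)) \<sqsubseteq>\<^bsub>fib P A\<^esub> a A (ec_class P (ident (base P) A, \<beta>))"
      using mono[OF f(5,5) cl[OF x] cl[OF ec_unit_pair[OF P f(5) \<beta>]]]
        ec_fib_le_iff[OF P x ec_unit_pair[OF P f(5) \<beta>]] by blast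
    then show "a A (ec_class P (f, \<alpha>)) \<sqsubseteq>\<^bsub>fib P A\<^esub> \<beta>" using unit[OF f(5) \<beta>] by simp
  qed
qed

text \<open>
  In a partial order the universal property determines the left adjoint, so the value of \<open>a\<close> is the
  one described by \<^const>\<open>ex_along\<close>; outside the carriers both families are \<^const>\<open>undefined\<close>.
\<close>

lemma algebra_eq_zeta:
  assumes alg: "is_algebra PD T\<^sub>e P (G, a)"
  shows "a = zeta P"
proof -
  note P = is_algebraD(1)[OF alg]
  interpret primary_doctrine P by (rule P)
  have a_ext: "a \<in> extensional (Obj (base P))"
    "\<And>A. A \<in> Obj (base P) \<Longrightarrow> a A \<in> extensional (carrier (ec_fib P A))"
    using is_algebraD(2)[OF alg] by (auto simp: PD_1cells_def)
  have "a A u = zeta P A u" if A: "A \<in> Obj (base P)" and u: "u \<in> carrier (ec_fib P A)" for A u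
  proof -
    obtain f \<alpha> where rep: "ec_rep u = (f, \<alpha>)" by fastforce
    have x: "(f, \<alpha>) \<in> ec_pairs P A" and cl: "ec_class P (f, \<alpha>) = u"
      using ec_rep_in_pairs[OF P u] rep by auto
    note adj = algebra_left_adjoint[OF alg x, unfolded cl]
    have au: "a A u \<in> carrier (fib P A)" using algebra_closed[OF alg A u] .
    have "ex_along P f \<alpha> = a A u"
      unfolding ex_along_def HomD(3)[OF ec_pairsD(1)[OF x]]
    proof (rule the_equality)
      fix \<beta>
      assume "\<beta> \<in> carrier (fib P A) \<and> (\<forall>\<gamma>\<in>carrier (fib P A). \<beta> \<sqsubseteq>\<^bsub>fib P A\<^esub> \<gamma> \<longleftrightarrow>
        \<alpha> \<sqsubseteq>\<^bsub>fib P (Dom (base P) f)\<^esub> reidx P f \<gamma>)"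
      then show "\<beta> = a A u"
        using adj au fib_le_refl[OF A] fib_le_antisym[OF A] by metis
    qed (use adj au in auto)
    then show ?thesis using A u rep by (simp add: zeta_def)
  qed
  then show ?thesis
    using a_ext by (intro ext) (auto simp: zeta_def extensional_def fun_eq_iff)
qed


section \<open>Lax morphisms\<close>

lemma PD_2cells_extensional:
  "\<theta> \<in> PD_2cells P R x y \<Longrightarrow> \<theta> \<in> extensional (Obj (base P))"
  by (cases x; cases y) (simp add: PD_2cells_def is_nat_trans_def)

text \<open>
  The functor part of the unit of the monad is the identity, so whiskering with it changes no
  component, and the unit law alone determines \<open>\<theta>\<close>.
\<close>

lemma lax_morphism_unique:
  assumes "is_lax_morphism PD T\<^sub>e P a R r (F, b) \<theta>"
  shows "\<theta> = id_nat (base P) (base R) F"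
proof -
  have unit: "whisker_right PD P (P\<^sup>e) R \<theta> (ec_unit P) = id2 PD P R (F, b)"
    using assms unfolding is_lax_morphism_def Let_def T\<^sub>e_simps by (elim conjE)
  have "\<exists>x y. \<theta> \<in> PD_2cells (P\<^sup>e) R x y"
    using assms unfolding is_lax_morphism_def Let_def T\<^sub>e_simps cells_PD by (elim conjE) (intro exI)
  then have "\<theta> \<in> extensional (Obj (base P))"
    using PD_2cells_extensional[of \<theta> "P\<^sup>e" R] by auto
  moreover have "(\<lambda>A\<in>Obj (base P). \<theta> (fobj (id_functor (base P)) A)) = id_nat (base P) (base R) F"
    using unit unfolding ec_unit_def ops_PD .
  moreover have "(\<lambda>A\<in>Obj (base P). \<theta> (fobj (id_functor (base P)) A)) = restrict \<theta> (Obj (base P))"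
    by (rule restrict_ext) simp
  ultimately show ?thesis by (simp add: extensional_restrict)
qed

text \<open>
  This is the mate of the naturality of \<open>b\<close>. Preservation of products by \<open>F\<close> matters here: it
  makes \<open>F g\<close> a projection of the target, so that the adjunction along \<open>F g\<close> is available.
\<close>

lemma algebra_lax_inequality:
  assumes algP: "is_algebra PD T\<^sub>e P (id_functor (base P), zeta P)"
    and algR: "is_algebra PD T\<^sub>e R (id_functor (base R), zeta R)"
    and Fb: "(F, b) \<in> PD_1cells P R"
    and A: "A \<in> Obj (base P)" and u: "u \<in> carrier (ec_fib P A)"
  shows "zeta R (fobj F A) (snd (ec_map P R (F, b)) A u) \<sqsubseteq>\<^bsub>fib R (fobj F A)\<^esub> b A (zeta P A u)"
    and "b A (zeta P A u) \<in> carrier (fib R (fobj F A))"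
proof -
  note P = is_algebraD(1)[OF algP] and R = is_algebraD(1)[OF algR]
  interpret P: primary_doctrine P by (rule P)
  interpret R: primary_doctrine R by (rule R)
  have F: "is_functor (base P) (base R) F" "preserves_finite_products (base P) (base R) F"
    and hom: "\<And>A. A \<in> Obj (base P) \<Longrightarrow> inf_semilattice_hom (fib P A) (fib R (fobj F A)) (b A)"
    and nat: "\<And>A B f \<beta>. f \<in> Hom (base P) A B \<Longrightarrow> \<beta> \<in> carrier (fib P B)
      \<Longrightarrow> b A (reidx P f \<beta>) = reidx R (farr F f) (b B \<beta>)"
    using Fb by (auto simp: PD_1cells_def)
  have bcl: "b A \<alpha> \<in> carrier (fib R (fobj F A))"
    if "A \<in> Obj (base P)" "\<alpha> \<in> carrier (fib P A)" for A \<alpha>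
    using hom[OF that(1)] that(2) by (auto simp: inf_semilattice_hom_def)
  obtain g \<alpha> where rep: "ec_rep u = (g, \<alpha>)" by fastforce
  have x: "(g, \<alpha>) \<in> ec_pairs P A" and cl: "ec_class P (g, \<alpha>) = u"
    using ec_rep_in_pairs[OF P u] rep by auto
  note g = P.ec_pairsD[OF x]
  let ?X = "Dom (base P) g" and ?e = "zeta P A u"
  have e: "?e \<in> carrier (fib P A)" using algebra_closed[OF algP A u] .
  then show be: "b A ?e \<in> carrier (fib R (fobj F A))" using bcl A by blast
  have Fg: "farr F g \<in> Hom (base R) (fobj F ?X) (fobj F A)"
    using F(1) g(1) by (auto simp: is_functor_def)
  have y: "(farr F g, b ?X \<alpha>) \<in> ec_pairs R (fobj F A)"
    using preserves_finite_products_projection[OF F(2) g(2)] bcl[OF g(4,3)] HomD[OF Fg]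
    by (simp add: ec_pairs_def)
  have "?e \<sqsubseteq>\<^bsub>fib P A\<^esub> ?e" using P.fib_le_refl A e by blast
  then have "\<alpha> \<sqsubseteq>\<^bsub>fib P ?X\<^esub> reidx P g ?e"
    using algebra_left_adjoint[OF algP x e] cl by simp
  then have "b ?X \<alpha> \<sqsubseteq>\<^bsub>fib R (fobj F ?X)\<^esub> b ?X (reidx P g ?e)"
    using inf_semilattice_hom_mono[OF hom[OF g(4)]
        inf_semilattice_partial_order[OF P.fib_inf_semilattice[OF g(4)]]]
      R.fib_inf_semilattice R.base.Hom_Obj(1)[OF Fg] P.reidx_closed[OF g(1) e] g(3) by blast
  then have "zeta R (fobj F A) (ec_class R (farr F g, b ?X \<alpha>)) \<sqsubseteq>\<^bsub>fib R (fobj F A)\<^esub> b A ?e"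
    using algebra_left_adjoint[OF algR y be] nat[OF g(1) e] HomD(2)[OF Fg] by simp
  then show "zeta R (fobj F A) (snd (ec_map P R (F, b)) A u) \<sqsubseteq>\<^bsub>fib R (fobj F A)\<^esub> b A ?e"
    using A u rep by (simp add: ec_map_def)
qed

lemma id_nat_lax_morphism:
  assumes algP: "is_algebra PD T\<^sub>e P (id_functor (base P), zeta P)"
    and algR: "is_algebra PD T\<^sub>e R (id_functor (base R), zeta R)"
    and Fb: "(F, b) \<in> PD_1cells P R"
  shows "is_lax_morphism PD T\<^sub>e P (id_functor (base P), zeta P) R (id_functor (base R), zeta R)
    (F, b) (id_nat (base P) (base R) F)"
proof -
  interpret P: primary_doctrine P by (rule is_algebraD(1)[OF algP])
  interpret R: primary_doctrine R by (rule is_algebraD(1)[OF algR])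
  let ?I = "id_nat (base P) (base R) F"
  have F: "is_functor (base P) (base R) F" using Fb by (auto simp: PD_1cells_def)
  have FObj: "fobj F A \<in> Obj (base R)" if "A \<in> Obj (base P)" for A
    using F that by (auto simp: is_functor_def)
  have FHom: "farr F f \<in> Hom (base R) (fobj F A) (fobj F B)" if "f \<in> Hom (base P) A B" for f A B
    using F that by (auto simp: is_functor_def)
  have idH: "ident (base R) (fobj F A) \<in> Hom (base R) (fobj F A) (fobj F A)"
    if "A \<in> Obj (base P)" for A using R.base.ident_in_Hom FObj[OF that] .
  have nt: "is_nat_trans (base P) (base R) F F ?I"
    unfolding is_nat_trans_def
  proof (intro conjI ballI allI)
    fix A B f assume f: "f \<in> Hom (base P) A B"
    show "farr F f \<cdot>\<^bsub>base R\<^esub> ?I A = ?I B \<cdot>\<^bsub>base R\<^esub> farr F f"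
      using P.base.Hom_Obj[OF f] R.base.Comp_ident[OF FHom[OF f]] R.base.ident_Comp[OF FHom[OF f]]
      by (simp add: id_nat_def)
  qed (use idH in \<open>auto simp: id_nat_def\<close>)
  have F1: "ec_map P R (F, b) = (F, snd (ec_map P R (F, b)))" by (simp add: ec_map_def)
  have cell: "?I \<in> cells2 PD (P\<^sup>e) R
    (comp1 PD (P\<^sup>e) (R\<^sup>e) R (id_functor (base R), zeta R) (ec_map P R (F, b)))
    (comp1 PD (P\<^sup>e) P R (F, b) (id_functor (base P), zeta P))"
    using nt algebra_lax_inequality[OF algP algR Fb] FObj R.reidx_ident
    by (subst F1) (simp add: PD_2cells_def ident_comp_functor[OF F] comp_functor_ident[OF F]
        id_nat_def)
  have whisker: "(\<lambda>A\<in>Obj (base P). ?I (fobj (id_functor (base P)) A)) = ?I"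
    "(\<lambda>A\<in>Obj (base P). farr (id_functor (base R)) (?I A)) = ?I"
    using HomD(1)[OF idH] by (auto simp: id_nat_def intro!: restrict_ext)
  have idem: "(\<lambda>A\<in>Obj (base P). ?I A \<cdot>\<^bsub>base R\<^esub> ?I A) = ?I"
    using R.base.Comp_ident[OF idH] by (auto simp: id_nat_def intro!: restrict_ext)
  show ?thesis
    unfolding is_lax_morphism_def Let_def
  proof (intro conjI)
    show "?I \<in> cells2 PD (T0 T\<^sub>e P) R
      (comp1 PD (T0 T\<^sub>e P) (T0 T\<^sub>e R) R (id_functor (base R), zeta R) (T1 T\<^sub>e P R (F, b)))
      (comp1 PD (T0 T\<^sub>e P) P R (F, b) (id_functor (base P), zeta P))"
      using cell by simp
  qed (use Fb in \<open>simp_all add: ec_map_def ec_unit_def whisker idem\<close>)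
qed

theorem theorem5p6:
  "(\<forall>(P :: 'u::infinite doctrine) R F b.
      is_algebra PD T\<^sub>e P (id_functor (base P), zeta P) \<longrightarrow>
      is_algebra PD T\<^sub>e R (id_functor (base R), zeta R) \<longrightarrow>
      (F, b) \<in> cells1 PD P R \<longrightarrow>
        is_lax_morphism PD T\<^sub>e
          P (id_functor (base P), zeta P) R (id_functor (base R), zeta R)
          (F, b) (id_nat (base P) (base R) F) \<and>
        (\<forall>\<theta>. is_lax_morphism PD T\<^sub>e
               P (id_functor (base P), zeta P) R (id_functor (base R), zeta R) (F, b) \<theta>
             \<longrightarrow> \<theta> = id_nat (base P) (base R) F)) \<and>
   lax_idempotent (PD :: ('u doctrine, 'u doctrine_map, 'u \<Rightarrow> 'u) two_cat) T\<^sub>e"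
proof (intro conjI allI impI)
  fix P R :: "'u doctrine" and F b
  assume "is_algebra PD T\<^sub>e P (id_functor (base P), zeta P)"
    "is_algebra PD T\<^sub>e R (id_functor (base R), zeta R)" "(F, b) \<in> cells1 PD P R"
  then show "is_lax_morphism PD T\<^sub>e P (id_functor (base P), zeta P)
      R (id_functor (base R), zeta R) (F, b) (id_nat (base P) (base R) F)"
    using id_nat_lax_morphism by simp
next
  fix P R :: "'u doctrine" and F b \<theta>
  assume "is_lax_morphism PD T\<^sub>e P (id_functor (base P), zeta P)
    R (id_functor (base R), zeta R) (F, b) \<theta>"
  then show "\<theta> = id_nat (base P) (base R) F" by (rule lax_morphism_unique)
next
  show "lax_idempotent (PD :: ('u doctrine, 'u doctrine_map, 'u \<Rightarrow> 'u) two_cat) T\<^sub>e"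
    unfolding lax_idempotent_def
  proof (intro allI impI)
    fix P R :: "'u doctrine" and a r f :: "'u doctrine_map"
    assume alg: "is_algebra PD T\<^sub>e P a" "is_algebra PD T\<^sub>e R r" and f: "f \<in> cells1 PD P R"
    obtain F b where Fb: "f = (F, b)" by (cases f)
    have "a = (id_functor (base P), zeta P)" "r = (id_functor (base R), zeta R)"
      using alg algebra_functor algebra_eq_zeta by (metis surj_pair)+
    then show "\<exists>!\<phi>. is_lax_morphism PD T\<^sub>e P a R r f \<phi>"
      using alg f id_nat_lax_morphism lax_morphism_unique unfolding Fb
      by (intro ex1I[of _ "id_nat (base P) (base R) F"]) auto
  qed
qed

end
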